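(* Let $G$ be a finite simple graph with no isolated vertices and let $t\in\mathbb{N}$. If $G \neq \widetilde G$ (i.e. $G$ has at least one pair of twins) and $G$ has a minimum twin cover that is a determining set, then \[ \det(\mu^{(t)}(G)) = (t+1)\det(G). \]
   Context: For $t \in \mathbb{N}$ and a graph $G$ with $V(G)=\{v_1,\dots,v_n\}$, the generalized Mycielskian $\mu^{(t)}(G)$ has vertex set $\{u_i^s : 1\le i\le n,\ 0\le s\le t\} \cup \{w\}$, with $u_i^0$ identified with $v_i$. For each edge $v_iv_j$ of $G$ it has edges $u_i^0u_j^0$ and $u_i^su_j^{s+1}$, $u_j^su_i^{s+1}$ for $0 \le s < t$; also edges $u_i^t w$ for $1 \le i \le n$; no other edges. Two vertices are twins if they have the same open neighborhood. Define $x\sim y$ if $x=y$ or $x,y$ are twins; the quotient graph $\widetilde G$ has the classes $[x]$ as vertices, with $[x]$ adjacent to $[z]$ iff $x$ is adjacent to $z$ in $G$ ($G=\widetilde G$ exactly when $G$ is twin-free). A minimum twin cover of $G$ is a minimum size subset of $V(G)$ containing at least one vertex from every pair of twins. A determining set is a vertex set such that only the identity automorphism fixes each of its vertices; $\det$ denotes the minimum size of one. *)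

theory Defs
  imports "Graph_Theory.Graph_Theory" "HOL-Combinatorics.Permutations"
begin

text \<open>
  Finite simple graphs are represented by \<^locale>\<open>pair_graph\<close>: finitely many vertices and a
  symmetric irreflexive adjacency relation \<^const>\<open>parcs\<close>, so that each undirected edge is
  represented by its two orientations.
\<close>

definition open_nbhd :: "'a pair_pre_digraph \<Rightarrow> 'a \<Rightarrow> 'a set" where
  "open_nbhd G x = {y. (x, y) \<in> parcs G}"

definition no_isolated_verts :: "'a pair_pre_digraph \<Rightarrow> bool" where
  "no_isolated_verts G \<longleftrightarrow> (\<forall>x \<in> pverts G. open_nbhd G x \<noteq> {})"


subsection \<open>Automorphisms and determining sets\<close>

text \<open>
  Automorphisms are extended by the identity outside the vertex set, so that ``identity
  automorphism'' is literally \<^const>\<open>id\<close>.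
\<close>

definition graph_automorphism :: "'a pair_pre_digraph \<Rightarrow> ('a \<Rightarrow> 'a) \<Rightarrow> bool" where
  "graph_automorphism G f \<longleftrightarrow> f permutes pverts G \<and>
     (\<forall>x \<in> pverts G. \<forall>y \<in> pverts G. (f x, f y) \<in> parcs G \<longleftrightarrow> (x, y) \<in> parcs G)"

definition determining_set :: "'a pair_pre_digraph \<Rightarrow> 'a set \<Rightarrow> bool" where
  "determining_set G S \<longleftrightarrow> S \<subseteq> pverts G \<and>
     (\<forall>f. graph_automorphism G f \<and> (\<forall>x \<in> S. f x = x) \<longrightarrow> f = id)"

definition det_number :: "'a pair_pre_digraph \<Rightarrow> nat" where
  "det_number G = (LEAST k. \<exists>S. determining_set G S \<and> card S = k)"


subsection \<open>Twins, twin covers and the twin quotient\<close>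

definition twins :: "'a pair_pre_digraph \<Rightarrow> 'a \<Rightarrow> 'a \<Rightarrow> bool" where
  "twins G x y \<longleftrightarrow> x \<in> pverts G \<and> y \<in> pverts G \<and> x \<noteq> y \<and> open_nbhd G x = open_nbhd G y"

definition twin_cover :: "'a pair_pre_digraph \<Rightarrow> 'a set \<Rightarrow> bool" where
  "twin_cover G T \<longleftrightarrow> T \<subseteq> pverts G \<and> (\<forall>x y. twins G x y \<longrightarrow> x \<in> T \<or> y \<in> T)"

definition min_twin_cover :: "'a pair_pre_digraph \<Rightarrow> 'a set \<Rightarrow> bool" where
  "min_twin_cover G T \<longleftrightarrow> is_arg_min card (twin_cover G) T"

definition twin_class :: "'a pair_pre_digraph \<Rightarrow> 'a \<Rightarrow> 'a set" where
  "twin_class G x = {y \<in> pverts G. x = y \<or> twins G x y}"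

definition twin_quotient :: "'a pair_pre_digraph \<Rightarrow> 'a set pair_pre_digraph" where
  "twin_quotient G =
     \<lparr> pverts = twin_class G ` pverts G,
       parcs = {(twin_class G x, twin_class G z) | x z. (x, z) \<in> parcs G} \<rparr>"

lemma twin_class_eq_iff:
  assumes "x \<in> pverts G" "y \<in> pverts G"
  shows "twin_class G x = twin_class G y \<longleftrightarrow> open_nbhd G x = open_nbhd G y"
proof -
  have "twin_class G u = {v \<in> pverts G. open_nbhd G u = open_nbhd G v}" if "u \<in> pverts G" for u
    using that unfolding twin_class_def twins_def by auto
  then show ?thesis
    using assms by auto
qed

lemma twin_quotient_adj_iff:
  assumes "pair_graph G" "x \<in> pverts G" "z \<in> pverts G"
  shows "(twin_class G x, twin_class G z) \<in> parcs (twin_quotient G) \<longleftrightarrow> (x, z) \<in> parcs G"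
proof
  interpret pair_graph G by fact
  have sym: "(b, a) \<in> parcs G" if "(a, b) \<in> parcs G" for a b
    using that pair_sym_arcs by (auto simp: symmetric_def dest: symD)
  assume "(twin_class G x, twin_class G z) \<in> parcs (twin_quotient G)"
  then obtain x' z' where eq: "twin_class G x = twin_class G x'" "twin_class G z = twin_class G z'"
    and xz': "(x', z') \<in> parcs G"
    unfolding twin_quotient_def by auto
  have "x' \<in> pverts G" "z' \<in> pverts G"
    using xz' in_arcsD1 in_arcsD2 by auto
  then have "open_nbhd G x = open_nbhd G x'" "open_nbhd G z = open_nbhd G z'"
    using eq assms(2,3) twin_class_eq_iff by metis+
  then show "(x, z) \<in> parcs G"
    using xz' sym unfolding open_nbhd_def by blast
qed (auto simp: twin_quotient_def)

text \<open>
  The vertices of the quotient are sets of vertices of \<open>G\<close>, so equality of \<open>G\<close> with its quotient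
  means isomorphism. This holds exactly when there are no twins.
\<close>

lemma not_iso_twin_quotient_iff:
  assumes "pair_graph G"
  shows "\<not> digraph_iso (with_proj G) (with_proj (twin_quotient G)) \<longleftrightarrow> (\<exists>x y. twins G x y)"
proof -
  interpret pair_graph G by fact
  show ?thesis
  proof
    assume non: "\<not> digraph_iso (with_proj G) (with_proj (twin_quotient G))"
    show "\<exists>x y. twins G x y"
    proof (rule ccontr)
      assume tf: "\<nexists>x y. twins G x y"
      let ?c = "twin_class G"
      have inj: "inj_on ?c (pverts G)"
        using tf by (auto simp: inj_on_def twin_class_def)
      define f where "f = \<lparr> iso_verts = ?c, iso_arcs = map_prod ?c ?c,
        iso_head = snd, iso_tail = fst \<rparr>"
      have "inj_on (map_prod ?c ?c) (parcs G)"
        by (rule inj_on_subset[OF map_prod_inj_on[OF inj inj]]) (auto dest: in_arcsD1 in_arcsD2)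
      then have "pre_digraph.digraph_isomorphism (with_proj G) f"
        using inj wf_digraph_axioms
        unfolding pre_digraph.digraph_isomorphism_def f_def by auto
      moreover have "with_proj (twin_quotient G) = app_iso f (with_proj G)"
        unfolding app_iso_def f_def with_proj_def twin_quotient_def by force
      ultimately show False
        using non unfolding digraph_iso_def by blast
    qed
  next
    assume "\<exists>x y. twins G x y"
    then obtain x y where xy: "twins G x y" by blast
    show "\<not> digraph_iso (with_proj G) (with_proj (twin_quotient G))"
    proof
      assume "digraph_iso (with_proj G) (with_proj (twin_quotient G))"
      then obtain f where "pre_digraph.digraph_isomorphism (with_proj G) f"
        and eq: "with_proj (twin_quotient G) = app_iso f (with_proj G)"
        unfolding digraph_iso_def by blast
      then have "inj_on (iso_verts f) (pverts G)"
        unfolding pre_digraph.digraph_isomorphism_def by simp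
      moreover have "pverts (twin_quotient G) = iso_verts f ` pverts G"
        using arg_cong[OF eq, of verts] by simp
      ultimately have "card (twin_class G ` pverts G) = card (pverts G)"
        by (simp add: card_image twin_quotient_def)
      then have "inj_on (twin_class G) (pverts G)"
        using pair_finite_verts by (simp add: eq_card_imp_inj_on)
      then show False
        using xy twin_class_eq_iff[of x G y] unfolding twins_def inj_on_def by blast
    qed
  qed
qed


subsection \<open>Generalized Mycielskians\<close>

text \<open>
  \<open>Shadow v s\<close> is the level-\<open>s\<close> copy of \<open>v\<close>; level \<open>0\<close> is the copy of the original graph. Since
  the arc set of \<open>G\<close> is symmetric, letting \<open>(x, y)\<close> range over all arcs gives both of the
  edges joining levels \<open>s\<close> and \<open>s + 1\<close> that arise from one edge of \<open>G\<close>.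
\<close>

datatype 'a myc_vert = Shadow 'a nat | Apex

definition mycielskian :: "nat \<Rightarrow> 'a pair_pre_digraph \<Rightarrow> 'a myc_vert pair_pre_digraph" where
  "mycielskian t G =
     \<lparr> pverts = {Shadow x s | x s. x \<in> pverts G \<and> s \<le> t} \<union> {Apex},
       parcs = {(Shadow x 0, Shadow y 0) | x y. (x, y) \<in> parcs G}
         \<union> {(Shadow x s, Shadow y (Suc s)) | x y s. (x, y) \<in> parcs G \<and> s < t}
         \<union> {(Shadow y (Suc s), Shadow x s) | x y s. (x, y) \<in> parcs G \<and> s < t}
         \<union> {(Shadow x t, Apex) | x. x \<in> pverts G}
         \<union> {(Apex, Shadow x t) | x. x \<in> pverts G} \<rparr>"

lemma pair_graph_mycielskian:
  assumes "pair_graph G"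
  shows "pair_graph (mycielskian t G)"
proof -
  interpret pair_graph G by fact
  have sym: "(b, a) \<in> parcs G" if "(a, b) \<in> parcs G" for a b
    using that pair_sym_arcs by (auto simp: symmetric_def dest: symD)
  let ?M = "mycielskian t G"
  have "pverts ?M = case_prod Shadow ` (pverts G \<times> {..t}) \<union> {Apex}"
    by (auto simp: mycielskian_def)
  then have fin: "finite (pverts ?M)"
    using pair_finite_verts by simp
  have sub: "parcs ?M \<subseteq> pverts ?M \<times> pverts ?M"
    using in_arcsD1 in_arcsD2 by (fastforce simp: mycielskian_def)
  show ?thesis
  proof
    show "finite (parcs ?M)"
      using fin sub by (meson finite_SigmaI finite_subset)
    have "sym (parcs ?M)"
      unfolding sym_def mycielskian_def using sym by auto
    then show "symmetric (with_proj ?M)"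
      by (simp add: symmetric_def)
    show "fst e \<noteq> snd e" if "e \<in> parcs ?M" for e
      using that pair_no_loops by (fastforce simp: mycielskian_def)
  qed (use fin sub in auto)
qed

end

theory Submission
  imports Defs
begin

text \<open>
  Swapping two twins is an automorphism, so every determining set is a twin cover. Each level of a
  twin cover of the Mycielskian is a twin cover of \<open>G\<close>; this gives the lower bound, and also
  \<open>det G = |T|\<close> for the given minimum twin cover \<open>T\<close>.

  For the upper bound, let \<open>f\<close> be an automorphism of the Mycielskian fixing all copies of all
  vertices of \<open>T\<close>. Since \<open>G\<close> has twins, \<open>T\<close> contains some \<open>x\<close>, and the apex is the only vertex
  adjacent to the level-\<open>t\<close> copy of \<open>x\<close> but not to its level-\<open>(t - 2)\<close> copy (level \<open>0\<close> if \<open>t = 1\<close>).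
  So \<open>f\<close> fixes the apex, hence preserves the levels, and its restriction to level \<open>0\<close> is an
  automorphism of \<open>G\<close> fixing \<open>T\<close>, that is, the identity. Going up, once level \<open>s\<close> is fixed pointwise,
  a vertex of level \<open>s + 1\<close> can only be moved to a twin, and of two twins one is fixed.
\<close>

subsection \<open>Determining sets and twin covers\<close>

lemma pair_graph_arc_sym:
  assumes "pair_graph G" "(x, y) \<in> parcs G"
  shows "(y, x) \<in> parcs G"
proof -
  interpret pair_graph G by fact
  show ?thesis
    using assms(2) pair_sym_arcs by (auto simp: symmetric_def dest: symD)
qed

lemma pair_graph_arc_verts:
  assumes "pair_graph G" "(x, y) \<in> parcs G"
  shows "x \<in> pverts G" "y \<in> pverts G"
proof -
  interpret pair_graph G by fact
  show "x \<in> pverts G" "y \<in> pverts G"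
    using assms(2) in_arcsD1 in_arcsD2 by auto
qed

lemma pair_graph_finite_verts:
  assumes "pair_graph G"
  shows "finite (pverts G)"
proof -
  interpret pair_graph G by fact
  show ?thesis by (rule pair_finite_verts)
qed

lemma graph_automorphism_image_nbhd:
  assumes "pair_graph G" "graph_automorphism G f" "x \<in> pverts G"
  shows "f ` open_nbhd G x = open_nbhd G (f x)"
proof -
  have p: "f permutes pverts G"
    and pres: "\<And>y. y \<in> pverts G \<Longrightarrow> (f x, f y) \<in> parcs G \<longleftrightarrow> (x, y) \<in> parcs G"
    using assms(2,3) unfolding graph_automorphism_def by auto
  show ?thesis
  proof (intro equalityI subsetI)
    fix z assume "z \<in> open_nbhd G (f x)"
    then have z: "(f x, z) \<in> parcs G" by (simp add: open_nbhd_def)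
    then have "z \<in> pverts G" using pair_graph_arc_verts[OF assms(1)] by blast
    then obtain y where "y \<in> pverts G" "z = f y"
      using permutes_image[OF p] by blast
    then show "z \<in> f ` open_nbhd G x"
      using z pres by (auto simp: open_nbhd_def)
  qed (use pres pair_graph_arc_verts[OF assms(1)] in \<open>auto simp: open_nbhd_def\<close>)
qed

lemma twins_transpose_automorphism:
  assumes "pair_graph G" "twins G x y"
  shows "graph_automorphism G (transpose x y)"
proof -
  have xy: "x \<in> pverts G" "y \<in> pverts G" and "open_nbhd G x = open_nbhd G y"
    using assms(2) unfolding twins_def by auto
  then have out: "(x, z) \<in> parcs G \<longleftrightarrow> (y, z) \<in> parcs G" for z
    unfolding open_nbhd_def by blast
  have "(transpose x y a, b) \<in> parcs G \<longleftrightarrow> (a, b) \<in> parcs G" for a b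
    using out[of b] by (simp add: transpose_def)
  \<comment> \<open>The swap is first absorbed in one coordinate; symmetry of the arc set then
    carries this over to the other.\<close>
  then have "(transpose x y a, transpose x y b) \<in> parcs G \<longleftrightarrow> (a, b) \<in> parcs G" for a b
    using pair_graph_arc_sym[OF assms(1)] by meson
  then show ?thesis
    using xy unfolding graph_automorphism_def by (auto intro: permutes_swap_id)
qed

lemma determining_set_imp_twin_cover:
  assumes "pair_graph G" "determining_set G S"
  shows "twin_cover G S"
  unfolding twin_cover_def
proof (intro conjI allI impI)
  show "S \<subseteq> pverts G" using assms(2) unfolding determining_set_def by blast
  fix x y assume tw: "twins G x y"
  show "x \<in> S \<or> y \<in> S"
  proof (rule ccontr)
    assume "\<not> (x \<in> S \<or> y \<in> S)"
    then have "\<forall>z \<in> S. transpose x y z = z"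
      by (auto simp: transpose_def)
    then have "transpose x y = id"
      using assms(2) twins_transpose_automorphism[OF assms(1) tw]
      unfolding determining_set_def by blast
    then show False
      using tw unfolding twins_def by (metis id_apply transpose_apply_first)
  qed
qed

lemma det_number_eqI:
  assumes "determining_set G S" "\<And>S'. determining_set G S' \<Longrightarrow> card S \<le> card S'"
  shows "det_number G = card S"
  unfolding det_number_def using assms by (intro Least_equality) auto

lemma min_twin_cover_le:
  assumes "min_twin_cover G T" "twin_cover G T'"
  shows "card T \<le> card T'"
  using assms unfolding min_twin_cover_def is_arg_min_def by force

lemma det_number_eq_card_min_twin_cover:
  assumes "pair_graph G" "min_twin_cover G T" "determining_set G T"
  shows "det_number G = card T"
  using assms(3)
  by (rule det_number_eqI) (rule min_twin_cover_le[OF assms(2)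
      determining_set_imp_twin_cover[OF assms(1)]])

subsection \<open>Generalized Mycielskians\<close>

lemma mem_pverts_mycielskian [simp]:
  "Shadow x s \<in> pverts (mycielskian t G) \<longleftrightarrow> x \<in> pverts G \<and> s \<le> t"
  "Apex \<in> pverts (mycielskian t G)"
  by (auto simp: mycielskian_def)

lemma mem_parcs_mycielskian:
  assumes "pair_graph G"
  shows "(Shadow x s, Shadow y r) \<in> parcs (mycielskian t G) \<longleftrightarrow>
      (x, y) \<in> parcs G \<and> (s = 0 \<and> r = 0 \<or> s < t \<and> r = Suc s \<or> r < t \<and> s = Suc r)"
    and "(Shadow x s, Apex) \<in> parcs (mycielskian t G) \<longleftrightarrow> x \<in> pverts G \<and> s = t"
    and "(Apex, Shadow x s) \<in> parcs (mycielskian t G) \<longleftrightarrow> x \<in> pverts G \<and> s = t"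
    and "(Apex, Apex) \<notin> parcs (mycielskian t G)"
  using pair_graph_arc_sym[OF assms] by (auto simp: mycielskian_def)

section \<open>Lower bound: twin covers level by level\<close>

lemma twins_mycielskian:
  assumes "pair_graph G" "twins G x y" "s \<le> t"
  shows "twins (mycielskian t G) (Shadow x s) (Shadow y s)"
proof -
  have xy: "x \<in> pverts G" "y \<in> pverts G" "x \<noteq> y" and "open_nbhd G x = open_nbhd G y"
    using assms(2) unfolding twins_def by auto
  then have out: "(x, z) \<in> parcs G \<longleftrightarrow> (y, z) \<in> parcs G" for z
    unfolding open_nbhd_def by blast
  \<comment> \<open>Adjacency of \<open>Shadow x s\<close> to another shadow depends on
    \<open>x\<close> only through its neighbourhood in \<open>G\<close>, and adjacency to
    \<open>Apex\<close> only on \<open>s\<close>.\<close>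
  have "(Shadow x s, z) \<in> parcs (mycielskian t G) \<longleftrightarrow>
    (Shadow y s, z) \<in> parcs (mycielskian t G)" for z
    using xy out by (cases z) (simp_all add: mem_parcs_mycielskian[OF assms(1)])
  then show ?thesis
    using xy assms(3) by (simp add: twins_def open_nbhd_def)
qed

lemma card_shadows: "card ((\<lambda>(x, s). Shadow x s) ` (T \<times> {..t})) = (t + 1) * card T"
proof -
  have "inj_on (\<lambda>(x, s). Shadow x s) (T \<times> {..t})"
    by (auto simp: inj_on_def)
  then show ?thesis by (simp add: card_image card_cartesian_product)
qed

text \<open>The slices \<open>L s\<close> of \<open>C\<close> are disjoint as sets of shadows, and
  each of the \<open>t + 1\<close> slices is a twin cover of \<open>G\<close>, so it has at least
  \<open>card T\<close> elements.\<close>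

lemma card_twin_cover_mycielskian_ge:
  assumes "pair_graph G" "min_twin_cover G T" "twin_cover (mycielskian t G) C"
  shows "(t + 1) * card T \<le> card C"
proof -
  define L where "L s = {x. Shadow x s \<in> C}" for s
  have sub: "C \<subseteq> pverts (mycielskian t G)"
    using assms(3) unfolding twin_cover_def by blast
  have "finite (pverts (mycielskian t G))"
    by (intro pair_graph_finite_verts pair_graph_mycielskian assms(1))
  then have fin: "finite C"
    using sub finite_subset by blast
  have Lsub: "L s \<subseteq> pverts G" for s
    using sub by (auto simp: L_def)
  have finL: "finite (L s)" for s
    unfolding L_def using finite_vimageI[OF fin, of "\<lambda>x. Shadow x s"]
    by (simp add: vimage_def inj_def)
  have "twin_cover G (L s)" if "s \<le> t" for s
    using assms(3) twins_mycielskian[OF assms(1) _ that] Lsub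
    unfolding twin_cover_def L_def by blast
  then have le: "card T \<le> card (L s)" if "s \<le> t" for s
    using that min_twin_cover_le[OF assms(2)] by blast
  have "(t + 1) * card T = (\<Sum>s\<le>t. card T)" by simp
  also have "\<dots> \<le> (\<Sum>s\<le>t. card (L s))"
    by (rule sum_mono) (use le in auto)
  also have "\<dots> = (\<Sum>s\<le>t. card ((\<lambda>x. Shadow x s) ` L s))"
    by (intro sum.cong refl card_image[symmetric]) (auto simp: inj_on_def)
  also have "\<dots> = card (\<Union>s\<le>t. (\<lambda>x. Shadow x s) ` L s)"
    by (rule card_UN_disjoint[symmetric]) (use finL in auto)
  also have "\<dots> \<le> card C"
    by (rule card_mono[OF fin]) (auto simp: L_def)
  finally show ?thesis .
qed

section \<open>Upper bound: automorphisms fixing the copies of a twin cover\<close>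

lemma automorphism_fixes_Apex:
  assumes "pair_graph G" "t \<ge> 1" "graph_automorphism (mycielskian t G) f" "x \<in> pverts G"
    and fixed: "\<And>s. s \<le> t \<Longrightarrow> f (Shadow x s) = Shadow x s"
  shows "f Apex = Apex"
proof -
  let ?M = "mycielskian t G"
  let ?N = "open_nbhd ?M"
  have nbhd: "f ` ?N (Shadow x s) = ?N (Shadow x s)" if "s \<le> t" for s
    using graph_automorphism_image_nbhd[OF pair_graph_mycielskian[OF assms(1)] assms(3)]
      assms(4) fixed[OF that] that by simp
  \<comment> \<open>Apart from \<open>Apex\<close>, the neighbours of \<open>Shadow x t\<close> lie
    on level \<open>t - 1\<close>, and \<open>Shadow x (t - 2)\<close> shares all of them. For
    \<open>t = 1\<close> the subtraction truncates to level 0, where the edges inside level 0 do the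
    same.\<close>
  have "z \<in> ?N (Shadow x t) - ?N (Shadow x (t - 2)) \<longleftrightarrow> z = Apex" for z
    using assms(2,4) by (cases z) (auto simp: open_nbhd_def mem_parcs_mycielskian[OF assms(1)])
  then have eq: "?N (Shadow x t) - ?N (Shadow x (t - 2)) = {Apex}"
    by blast
  have "inj f"
    using assms(3) permutes_inj unfolding graph_automorphism_def by blast
  then have "f ` {Apex} = {Apex}"
    using nbhd unfolding eq[symmetric] by (simp add: image_set_diff)
  then show ?thesis by simp
qed

text \<open>Levels are recognised from the apex downwards, level \<open>t\<close> being its
  neighbourhood. The induction on \<open>t - s\<close> is strong because level \<open>s\<close> is
  handled using both level \<open>s + 1\<close> and level \<open>s + 2\<close>.\<close>

lemma automorphism_preserves_levels:
  assumes "pair_graph G" "no_isolated_verts G" "graph_automorphism (mycielskian t G) f"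
    and apex: "f Apex = Apex"
  shows "x \<in> pverts G \<Longrightarrow> s \<le> t \<Longrightarrow> \<exists>y \<in> pverts G. f (Shadow x s) = Shadow y s"
proof (induction "t - s" arbitrary: x s rule: less_induct)
  case less
  let ?M = "mycielskian t G"
  have p: "f permutes pverts ?M"
    and pres: "\<And>a b. a \<in> pverts ?M \<Longrightarrow> b \<in> pverts ?M \<Longrightarrow>
      (f a, f b) \<in> parcs ?M \<longleftrightarrow> (a, b) \<in> parcs ?M"
    using assms(3) unfolding graph_automorphism_def by auto
  note inj = injD[OF permutes_inj[OF p]]
  note arcs = mem_parcs_mycielskian[OF assms(1)]
  have V: "Shadow x s \<in> pverts ?M" using less.prems by simp
  have fV: "f (Shadow x s) \<in> pverts ?M" using V permutes_in_image[OF p] by blast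
  have "f (Shadow x s) \<noteq> Apex" using inj apex by (metis myc_vert.distinct(1))
  then obtain y r where y: "f (Shadow x s) = Shadow y r" "y \<in> pverts G" "r \<le> t"
    using fV by (cases "f (Shadow x s)") auto
  show ?case
  proof (cases "s = t")
    case True
    then have "(f (Shadow x s), f Apex) \<in> parcs ?M"
      using pres[OF V] less.prems arcs by simp
    then show ?thesis using True y apex arcs by simp
  next
    case False
    then have "s < t" using less.prems by simp
    obtain z where z: "(x, z) \<in> parcs G"
      using assms(2) less.prems unfolding no_isolated_verts_def open_nbhd_def by blast
    then have zV: "z \<in> pverts G" using pair_graph_arc_verts[OF assms(1)] by blast
    obtain z' where z': "f (Shadow z (Suc s)) = Shadow z' (Suc s)"
      using less.hyps[OF _ zV, of "Suc s"] \<open>s < t\<close> by (meson Suc_leI diff_less_mono2 lessI)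
    have "(f (Shadow x s), f (Shadow z (Suc s))) \<in> parcs ?M"
      using pres[OF V] z zV \<open>s < t\<close> arcs by simp
    \<comment> \<open>The image is adjacent to a vertex of level \<open>Suc s\<close>, which is
      positive, so the edges inside level 0 do not interfere.\<close>
    then have "r = s \<or> r = Suc (Suc s)" using y z' arcs by auto
    moreover have "r \<noteq> Suc (Suc s)"
    proof
      txt \<open>By finiteness \<open>f\<close> maps level \<open>s + 2\<close> onto itself, so no other vertex can be mapped there.\<close>
      assume r: "r = Suc (Suc s)"
      let ?g = "\<lambda>v. f (Shadow v r)"
      have fin: "finite (pverts G)" by (rule pair_graph_finite_verts[OF assms(1)])
      have "\<exists>z \<in> pverts G. ?g v = Shadow z r" if "v \<in> pverts G" for v
        using less.hyps[OF _ that y(3)] r y(3) by simp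
      then have "?g ` pverts G \<subseteq> (\<lambda>v. Shadow v r) ` pverts G"
        by blast
      moreover have "card (?g ` pverts G) = card ((\<lambda>v. Shadow v r) ` pverts G)"
        by (subst (1 2) card_image) (auto simp: inj_on_def dest: inj)
      ultimately have "?g ` pverts G = (\<lambda>v. Shadow v r) ` pverts G"
        using fin by (intro card_subset_eq) auto
      then have "Shadow y r \<in> ?g ` pverts G"
        using y(2) by simp
      then obtain v where "f (Shadow v r) = Shadow y r"
        by auto
      then have "Shadow v r = Shadow x s" using y(1) inj by metis
      then show False using r by simp
    qed
    ultimately show ?thesis using y by blast
  qed
qed

lemma automorphism_fixes_levels:
  assumes "pair_graph G" "no_isolated_verts G" "twin_cover G T"
    and "graph_automorphism (mycielskian t G) f"
    and fixT: "\<And>x s. x \<in> T \<Longrightarrow> s \<le> t \<Longrightarrow> f (Shadow x s) = Shadow x s"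
    and fix0: "\<And>x. x \<in> pverts G \<Longrightarrow> f (Shadow x 0) = Shadow x 0"
    and levels: "\<And>x s. x \<in> pverts G \<Longrightarrow> s \<le> t \<Longrightarrow> \<exists>y \<in> pverts G. f (Shadow x s) = Shadow y s"
  shows "x \<in> pverts G \<Longrightarrow> s \<le> t \<Longrightarrow> f (Shadow x s) = Shadow x s"
proof (induction s arbitrary: x)
  case 0
  then show ?case using fix0 by simp
next
  case (Suc s)
  let ?M = "mycielskian t G"
  have p: "f permutes pverts ?M"
    and pres: "\<And>a b. a \<in> pverts ?M \<Longrightarrow> b \<in> pverts ?M \<Longrightarrow>
      (f a, f b) \<in> parcs ?M \<longleftrightarrow> (a, b) \<in> parcs ?M"
    using assms(4) unfolding graph_automorphism_def by auto
  obtain y where y: "y \<in> pverts G" "f (Shadow x (Suc s)) = Shadow y (Suc s)"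
    using levels Suc.prems by blast
  \<comment> \<open>\<open>Shadow z s\<close> is fixed by the induction hypothesis, so the
    neighbours one level below, which mirror the neighbourhood in \<open>G\<close>, are the same for
    \<open>Shadow x (Suc s)\<close> and its image.\<close>
  have "(y, z) \<in> parcs G \<longleftrightarrow> (x, z) \<in> parcs G" if z: "z \<in> pverts G" for z
    using pres[of "Shadow x (Suc s)" "Shadow z s"] Suc z y mem_parcs_mycielskian[OF assms(1)]
    by auto
  then have "open_nbhd G x = open_nbhd G y"
    using pair_graph_arc_verts[OF assms(1)] unfolding open_nbhd_def by blast
  then have "x = y \<or> twins G x y"
    using y Suc.prems unfolding twins_def by blast
  then consider "x = y" | "x \<in> T" | "y \<in> T"
    using assms(3) unfolding twin_cover_def by blast
  then show ?case
  proof cases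
    case 3
    \<comment> \<open>The image is itself a fixed point, so injectivity forces
      \<open>x = y\<close>.\<close>
    then have "f (Shadow y (Suc s)) = f (Shadow x (Suc s))"
      using fixT Suc.prems y by simp
    then show ?thesis using injD[OF permutes_inj[OF p]] y by metis
  qed (use y fixT Suc.prems in auto)
qed

lemma determining_set_mycielskian:
  assumes "pair_graph G" "no_isolated_verts G" "t \<ge> 1"
    and "twin_cover G T" "determining_set G T" "T \<noteq> {}"
  shows "determining_set (mycielskian t G) ((\<lambda>(x, s). Shadow x s) ` (T \<times> {..t}))"
  unfolding determining_set_def
proof (intro conjI allI impI)
  let ?M = "mycielskian t G"
  let ?S = "(\<lambda>(x, s). Shadow x s) ` (T \<times> {..t})"
  have TV: "T \<subseteq> pverts G" using assms(4) unfolding twin_cover_def by blast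
  then show "?S \<subseteq> pverts ?M" by auto
  fix f assume f: "graph_automorphism ?M f \<and> (\<forall>x \<in> ?S. f x = x)"
  then have aut: "graph_automorphism ?M f" by blast
  then have p: "f permutes pverts ?M"
    and pres: "\<And>a b. a \<in> pverts ?M \<Longrightarrow> b \<in> pverts ?M \<Longrightarrow>
      (f a, f b) \<in> parcs ?M \<longleftrightarrow> (a, b) \<in> parcs ?M"
    unfolding graph_automorphism_def by auto
  have fixT: "f (Shadow x s) = Shadow x s" if "x \<in> T" "s \<le> t" for x s
    using f that by auto
  have apex: "f Apex = Apex"
    using automorphism_fixes_Apex[OF assms(1,3) aut] assms(6) TV fixT by blast
  note levels = automorphism_preserves_levels[OF assms(1,2) aut apex]

  \<comment> \<open>This is \<open>f\<close> on level 0, read as a map on \<open>G\<close>.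
    Preservation of levels makes the description unique, and the value \<open>x\<close> outside
    \<open>pverts G\<close> makes \<open>g\<close> a permutation in the sense of
    \<open>permutes\<close>.\<close>
  define g where "g x = (if x \<in> pverts G then THE y. f (Shadow x 0) = Shadow y 0 else x)" for x
  have g: "f (Shadow x 0) = Shadow (g x) 0" "g x \<in> pverts G" if "x \<in> pverts G" for x
    using levels[OF that, of 0] that by (auto simp: g_def)
  have "inj_on g (pverts G)"
  proof (rule inj_onI)
    fix x y assume xy: "x \<in> pverts G" "y \<in> pverts G" "g x = g y"
    then have "f (Shadow x 0) = f (Shadow y 0)" using g(1) by simp
    then show "x = y" using injD[OF permutes_inj[OF p]] by blast
  qed
  moreover have fin: "finite (pverts G)" by (rule pair_graph_finite_verts[OF assms(1)])
  ultimately have "bij_betw g (pverts G) (pverts G)"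
    using g(2) endo_inj_surj[of "pverts G" g] by (simp add: bij_betw_def image_subset_iff)
  then have "g permutes pverts G"
    by (rule bij_imp_permutes) (simp add: g_def)
  moreover have "(g x, g y) \<in> parcs G \<longleftrightarrow> (x, y) \<in> parcs G"
    if "x \<in> pverts G" "y \<in> pverts G" for x y
    using pres[of "Shadow x 0" "Shadow y 0"] g that mem_parcs_mycielskian[OF assms(1)] by simp
  ultimately have "graph_automorphism G g"
    unfolding graph_automorphism_def by blast
  moreover have "\<forall>x \<in> T. g x = x"
    using fixT g(1) TV by (metis le0 myc_vert.inject subsetD)
  ultimately have "g = id"
    using assms(5) unfolding determining_set_def by blast
  then have fix0: "f (Shadow x 0) = Shadow x 0" if "x \<in> pverts G" for x
    using g(1) that by simp

  have "f v = v" if "v \<in> pverts ?M" for v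
    using automorphism_fixes_levels[OF assms(1,2,4) aut fixT fix0 levels] apex that
    by (cases v) auto
  then show "f = id"
    using permutes_not_in[OF p] by (metis eq_id_iff)
qed

theorem theorem6:
  fixes G :: "'a pair_pre_digraph" and t :: nat
  assumes "pair_graph G"
    and "no_isolated_verts G"
    and "t \<ge> 1"
    and "\<not> digraph_iso (with_proj G) (with_proj (twin_quotient G))"
    and "\<exists>T. min_twin_cover G T \<and> determining_set G T"
  shows "det_number (mycielskian t G) = (t + 1) * det_number G"
proof -
  obtain T where T: "min_twin_cover G T" "determining_set G T"
    using assms(5) by blast
  have cover: "twin_cover G T"
    using determining_set_imp_twin_cover[OF assms(1) T(2)] .
  moreover obtain x y where "twins G x y"
    using not_iso_twin_quotient_iff[OF assms(1)] assms(4) by blast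
  \<comment> \<open>A pair of twins forces an element into \<open>T\<close>; its fixed copies are
    what pins down the apex.\<close>
  ultimately have "T \<noteq> {}" unfolding twin_cover_def by blast
  note det = determining_set_mycielskian[OF assms(1-3) cover T(2) this]
  have "(t + 1) * card T \<le> card S" if "determining_set (mycielskian t G) S" for S
    using card_twin_cover_mycielskian_ge[OF assms(1) T(1)]
      determining_set_imp_twin_cover[OF pair_graph_mycielskian[OF assms(1)] that] by blast
  then show ?thesis
    using det_number_eqI[OF det] det_number_eq_card_min_twin_cover[OF assms(1) T]
    by (simp only: card_shadows)
qed

end
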